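(* Let $f=h+\overline{g}$ be a harmonic mapping of the unit disk $\mathbb{D}$ of the form $$f(z)=h(z)+\overline{g(z)}=z+\sum_{j=2}^{\infty}a_j z^j+\sum_{j=1}^{\infty}\overline{b_j z^j},\qquad |b_1|<1,$$ where $h(z)=z+\sum_{j\ge 2}a_jz^j$ and $g(z)=\sum_{j\ge1}b_jz^j$ are analytic in $\mathbb{D}$, and put $a_1=1$. Suppose that for some $\theta\in\mathbb{R}$ $$g'(z)=e^{i\theta}zh'(z)\quad\text{and}\quad \mathrm{Re}\left(1+z\frac{h''(z)}{h'(z)}\right)>-\frac12\qquad\text{for all } z\in\mathbb{D}.$$ Then $$|a_j|\le \frac{j+1}{2}\quad\text{and}\quad |b_j|\le\frac{j-1}{2}$$ for all $j=1,2,\ldots$.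
   Context: $\mathbb{D}=\{z\in\mathbb{C}:|z|<1\}$. A complex-valued harmonic mapping of $\mathbb{D}$ is a continuous mapping whose real and imaginary parts are harmonic in $\mathbb{D}$; it can be written $h+\overline{g}$ with $h,g$ analytic in $\mathbb{D}$. *)

theory Defs
  imports "HOL-Complex_Analysis.Complex_Analysis"
begin

text \<open>
  Meant for open \<open>S\<close>: \<open>u\<close> is twice continuously differentiable on \<open>S\<close>, with first partial
  derivatives \<open>ux\<close>, \<open>uy\<close> and second partial derivatives \<open>uxx\<close>, \<open>uxy\<close>, \<open>uyx\<close>, \<open>uyy\<close> in the
  real coordinates of \<open>z = x + \<i> y\<close>, and its Laplacian vanishes on \<open>S\<close>.
\<close>
definition harmonic_fun_on :: "(complex \<Rightarrow> real) \<Rightarrow> complex set \<Rightarrow> bool" where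
  "harmonic_fun_on u S \<longleftrightarrow>
    (\<exists>ux uy uxx uxy uyx uyy :: complex \<Rightarrow> real.
      (\<forall>z\<in>S. (u has_derivative (\<lambda>w. ux z * Re w + uy z * Im w)) (at z)) \<and>
      (\<forall>z\<in>S. (ux has_derivative (\<lambda>w. uxx z * Re w + uxy z * Im w)) (at z)) \<and>
      (\<forall>z\<in>S. (uy has_derivative (\<lambda>w. uyx z * Re w + uyy z * Im w)) (at z)) \<and>
      continuous_on S uxx \<and> continuous_on S uxy \<and>
      continuous_on S uyx \<and> continuous_on S uyy \<and>
      (\<forall>z\<in>S. uxx z + uyy z = 0))"

definition harmonic_map_on :: "(complex \<Rightarrow> complex) \<Rightarrow> complex set \<Rightarrow> bool" where
  "harmonic_map_on f S \<longleftrightarrow>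
    continuous_on S f \<and> harmonic_fun_on (\<lambda>z. Re (f z)) S \<and> harmonic_fun_on (\<lambda>z. Im (f z)) S"

lemma has_derivative_Re_holomorphic:
  assumes "F holomorphic_on S" "open S" "z \<in> S"
  shows "((\<lambda>z. Re (F z)) has_derivative
           (\<lambda>w. Re (deriv F z) * Re w + (- Im (deriv F z)) * Im w)) (at z)"
proof -
  have "(F has_field_derivative deriv F z) (at z)"
    using assms holomorphic_derivI by blast
  then have "(F has_derivative (\<lambda>w. deriv F z * w)) (at z)"
    by (simp add: has_field_derivative_def)
  from has_derivative_Re[OF this] show ?thesis
    by simp
qed

lemma has_derivative_Im_holomorphic:
  assumes "F holomorphic_on S" "open S" "z \<in> S"
  shows "((\<lambda>z. Im (F z)) has_derivative
           (\<lambda>w. Im (deriv F z) * Re w + Re (deriv F z) * Im w)) (at z)"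
proof -
  have "(F has_field_derivative deriv F z) (at z)"
    using assms holomorphic_derivI by blast
  then have "(F has_derivative (\<lambda>w. deriv F z * w)) (at z)"
    by (simp add: has_field_derivative_def)
  from has_derivative_Im[OF this] show ?thesis
    by (simp add: add.commute)
qed

lemma harmonic_fun_on_Re_holomorphic:
  assumes F: "F holomorphic_on S" and S: "open S"
  shows "harmonic_fun_on (\<lambda>z. Re (F z)) S"
proof -
  have F': "deriv F holomorphic_on S" and F'': "deriv (deriv F) holomorphic_on S"
    using assms by (simp_all add: holomorphic_deriv)
  have c: "continuous_on S (deriv (deriv F))"
    using F'' by (rule holomorphic_on_imp_continuous_on)
  have m: "((\<lambda>z. - Im (deriv F z)) has_derivative
      (\<lambda>w. - Im (deriv (deriv F) z) * Re w + (- Re (deriv (deriv F) z)) * Im w)) (at z)"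
    if "z \<in> S" for z
    using has_derivative_minus[OF has_derivative_Im_holomorphic[OF F' S that]]
    by (simp add: algebra_simps)
  show ?thesis
    unfolding harmonic_fun_on_def
    by (rule exI[of _ "\<lambda>z. Re (deriv F z)"], rule exI[of _ "\<lambda>z. - Im (deriv F z)"],
        rule exI[of _ "\<lambda>z. Re (deriv (deriv F) z)"],
        rule exI[of _ "\<lambda>z. - Im (deriv (deriv F) z)"],
        rule exI[of _ "\<lambda>z. - Im (deriv (deriv F) z)"],
        rule exI[of _ "\<lambda>z. - Re (deriv (deriv F) z)"])
      (intro conjI ballI has_derivative_Re_holomorphic[OF F S]
        has_derivative_Re_holomorphic[OF F' S] m continuous_intros c; simp)
qed

lemma harmonic_map_on_holomorphic_add_cnj:
  assumes h: "h holomorphic_on S" and g: "g holomorphic_on S" and S: "open S"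
  shows "harmonic_map_on (\<lambda>z. h z + cnj (g z)) S"
proof -
  have "harmonic_fun_on (\<lambda>z. Re (h z + g z)) S"
    by (intro harmonic_fun_on_Re_holomorphic holomorphic_intros h g S)
  moreover have "harmonic_fun_on (\<lambda>z. Re (- \<i> * (h z - g z))) S"
    by (intro harmonic_fun_on_Re_holomorphic holomorphic_intros h g S)
  moreover have "continuous_on S (\<lambda>z. h z + cnj (g z))"
    by (intro continuous_intros holomorphic_on_imp_continuous_on h g)
  ultimately show ?thesis
    by (simp add: harmonic_map_on_def)
qed

end

theory Submission
  imports Defs
begin

text \<open>
  The function \<open>p(z) = 3/2 + z h''(z)/h'(z)\<close> has positive real part and \<open>p(0) = 3/2\<close>, so by
  Caratheodory's estimate its further Taylor coefficients have modulus at most \<open>3\<close>. Comparing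
  coefficients in \<open>z h'' = (p - 3/2) h'\<close> bounds the coefficients of \<open>h'\<close> by those of \<open>(1 - z)\<^sup>-\<^sup>3\<close>,
  the extremal case, and \<open>g' = e\<^sup>i\<^sup>\<theta> z h'\<close> transfers the bound to \<open>g\<close>.
\<close>

text \<open>The parametrised circle \<open>c\<close> about 0 satisfies c' = 2 pi i c, so division by
  2 pi i turns a contour integral of \<open>f\<close> into the mean of f(u) u over the
  circle.\<close>

lemma has_integral_mean_of_circlepath:
  assumes "(f has_contour_integral 2 * of_real pi * \<i> * c) (circlepath 0 r)"
  shows "((\<lambda>t. f (circlepath 0 r t) * circlepath 0 r t) has_integral c) {0..1}"
proof -
  have "((\<lambda>t. f (circlepath 0 r t) * vector_derivative (circlepath 0 r) (at t))
          has_integral 2 * of_real pi * \<i> * c) {0..1}"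
    using assms by (simp add: has_contour_integral)
  then have "((\<lambda>t. (1 / (2 * of_real pi * \<i>)) *
      (f (circlepath 0 r t) * vector_derivative (circlepath 0 r) (at t)))
          has_integral (1 / (2 * of_real pi * \<i>)) * (2 * of_real pi * \<i> * c)) {0..1}"
    by (rule has_integral_mult_right)
  moreover have "vector_derivative (circlepath 0 r) (at t) = 2 * of_real pi * \<i> * circlepath 0 r t"
    for t
    by (simp add: vector_derivative_circlepath) (simp add: circlepath algebra_simps)
  ultimately show ?thesis
    by (simp add: field_simps)
qed

text \<open>On the circle, averaging p(u) / u^n gives the n-th coefficient, while averaging cnj
  (p(u)) / u^n gives 0. Adding the two expresses the coefficient through Re p alone, and positivity
  of Re p then bounds it by the mean of 2 Re p / r^n.\<close>

lemma caratheodory_coefficient_bound_radius: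
  assumes hol: "p holomorphic_on ball 0 1" and pos: "\<And>z. z \<in> ball 0 1 \<Longrightarrow> Re (p z) \<ge> 0"
    and n: "n \<ge> 1" and r: "0 < r" "r < 1"
  shows "norm ((deriv ^^ n) p 0 / fact n) * r ^ n \<le> 2 * Re (p 0)"
proof -
  define \<gamma> where "\<gamma> = circlepath 0 r"
  have norm_\<gamma>: "norm (\<gamma> t) = r" for t
    using r by (simp add: \<gamma>_def circlepath norm_mult)
  have \<gamma>0: "\<gamma> t \<noteq> 0" for t
    using norm_\<gamma>[of t] r by auto
  \<comment> \<open>This turns the conjugate of \<open>\<gamma> t ^ n\<close> into a multiple of its
    inverse.\<close>
  have cnj_\<gamma>: "cnj (\<gamma> t) = of_real (r\<^sup>2) / \<gamma> t" for t
    using complex_norm_square[of "\<gamma> t"] norm_\<gamma>[of t] \<gamma>0[of t]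
    by (simp add: field_simps)
  have cont: "continuous_on (cball 0 r) p"
    using hol r by (intro holomorphic_on_imp_continuous_on[OF holomorphic_on_subset[OF hol]]) auto
  have holr: "p holomorphic_on ball 0 r"
    using r by (intro holomorphic_on_subset[OF hol]) auto
  \<comment> \<open>Cauchy's formula has the power m + 1 in the denominator; the extra factor
    \<open>\<gamma> t\<close> of the mean cancels one. The case m = 0 is the mean value
    property.\<close>
  have coeff: "((\<lambda>t. p (\<gamma> t) / \<gamma> t ^ m) has_integral (deriv ^^ m) p 0 / fact m) {0..1}" for m
  proof -
    have "((\<lambda>u. p u / u ^ Suc m) has_contour_integral
            2 * of_real pi * \<i> * ((deriv ^^ m) p 0 / fact m)) (circlepath 0 r)"
      using Cauchy_has_contour_integral_higher_derivative_circlepath[OF cont holr, of 0 m] r by simp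
    from has_integral_mean_of_circlepath[OF this] show ?thesis
      using \<gamma>0 by (simp add: \<gamma>_def[symmetric])
  qed
  \<comment> \<open>Cauchy's theorem for p(u) u^(n - 1), which is holomorphic because n is at least
    1.\<close>
  have "((\<lambda>t. p (\<gamma> t) * \<gamma> t ^ n) has_integral 0) {0..1}"
  proof -
    have "((\<lambda>u. p u * u ^ (n - 1)) has_contour_integral 0) (circlepath 0 r)"
      using r by (intro Cauchy_theorem_disc_simple[of _ 0 1] holomorphic_intros hol) auto
    then have "((\<lambda>u. p u * u ^ (n - 1)) has_contour_integral 2 * of_real pi * \<i> * 0) (circlepath 0 r)"
      by simp
    from has_integral_mean_of_circlepath[OF this] show ?thesis
      using n by (simp add: \<gamma>_def[symmetric] power_eq_if mult_ac)
  qed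
  then have "((cnj \<circ> (\<lambda>t. p (\<gamma> t) * \<gamma> t ^ n)) has_integral cnj 0) {0..1}"
    by (rule has_integral_linear[OF _ bounded_linear_cnj])
  then have "((\<lambda>t. cnj (p (\<gamma> t)) * (of_real (r\<^sup>2) / \<gamma> t) ^ n) has_integral 0) {0..1}"
    by (simp add: o_def cnj_\<gamma>)
  then have "((\<lambda>t. (1 / of_real (r\<^sup>2) ^ n) * (cnj (p (\<gamma> t)) * (of_real (r\<^sup>2) / \<gamma> t) ^ n))
      has_integral (1 / of_real (r\<^sup>2) ^ n) * 0) {0..1}"
    by (rule has_integral_mult_right)
  then have "((\<lambda>t. cnj (p (\<gamma> t)) / \<gamma> t ^ n) has_integral 0) {0..1}"
    using r by (simp add: power_divide)
  from has_integral_add[OF coeff[of n] this]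
  have sum: "((\<lambda>t. of_real (2 * Re (p (\<gamma> t))) / \<gamma> t ^ n) has_integral (deriv ^^ n) p 0 / fact n) {0..1}"
    by (simp add: add_divide_distrib[symmetric] complex_add_cnj)
  have "((Re \<circ> (\<lambda>t. p (\<gamma> t))) has_integral Re (p 0)) {0..1}"
    using has_integral_linear[OF coeff[of 0] bounded_linear_Re] by simp
  then have mean: "((\<lambda>t. 2 / r ^ n * Re (p (\<gamma> t))) has_integral 2 / r ^ n * Re (p 0)) {0..1}"
    unfolding o_def by (rule has_integral_mult_right)
  have "norm (integral {0..1} (\<lambda>t. of_real (2 * Re (p (\<gamma> t))) / \<gamma> t ^ n))
      \<le> integral {0..1} (\<lambda>t. 2 / r ^ n * Re (p (\<gamma> t)))"
  proof (rule Henstock_Kurzweil_Integration.integral_norm_bound_integral)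
    fix t :: real
    have "Re (p (\<gamma> t)) \<ge> 0"
      using norm_\<gamma> r by (intro pos) auto
    then show "norm (of_real (2 * Re (p (\<gamma> t))) / \<gamma> t ^ n) \<le> 2 / r ^ n * Re (p (\<gamma> t))"
      by (simp add: norm_divide norm_power norm_\<gamma> norm_mult)
  qed (use sum mean in blast)+
  then have "norm ((deriv ^^ n) p 0 / fact n) \<le> 2 / r ^ n * Re (p 0)"
    unfolding integral_unique[OF sum] integral_unique[OF mean] .
  then show ?thesis
    using r by (simp add: field_simps)
qed

text \<open>Let r tend to 1 from the left in the bound on the circle of radius r.\<close>

lemma caratheodory_coefficient_bound:
  assumes hol: "p holomorphic_on ball 0 1" and pos: "\<And>z. z \<in> ball 0 1 \<Longrightarrow> Re (p z) \<ge> 0"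
    and n: "n \<ge> 1"
  shows "norm ((deriv ^^ n) p 0 / fact n) \<le> 2 * Re (p 0)"
proof (rule tendsto_upperbound)
  show "((\<lambda>r. norm ((deriv ^^ n) p 0 / fact n) * r ^ n) \<longlongrightarrow> norm ((deriv ^^ n) p 0 / fact n))
      (at_left (1 :: real))"
    by (rule tendsto_eq_intros refl | simp)+
  have "eventually (\<lambda>r. r \<in> {0<..<1}) (at_left (1 :: real))"
    by (rule eventually_at_leftI[of 0]) auto
  then show "eventually (\<lambda>r. norm ((deriv ^^ n) p 0 / fact n) * r ^ n \<le> 2 * Re (p 0)) (at_left 1)"
    by eventually_elim (use caratheodory_coefficient_bound_radius[OF hol pos n] in auto)
qed simp

text \<open>
  Since \<open>x / 0 = 0\<close>, the hypothesis holds for free at a zero of \<open>F\<close>. Nevertheless it excludes zeros: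
  it makes \<open>t \<mapsto> t\<^sup>k |F (t z)|\<^sup>2\<close> nondecreasing on \<open>[0, 1]\<close>, and this function is positive for small \<open>t > 0\<close>.
\<close>
lemma log_derivative_bounded_below_imp_nonzero:
  assumes hol: "F holomorphic_on ball 0 1" and F0: "F 0 \<noteq> 0"
    and lower: "\<And>z. z \<in> ball 0 1 \<Longrightarrow> Re (z * (deriv F z / F z)) \<ge> - (real k / 2)"
    and z: "z \<in> ball 0 1"
  shows "F z \<noteq> 0"
proof
  assume Fz: "F z = 0"
  \<comment> \<open>The squared modulus is spelled out in real and imaginary parts so that real
    differentiation rules apply.\<close>
  define u where "u t = t ^ k * ((Re (F (of_real t * z)))\<^sup>2 + (Im (F (of_real t * z)))\<^sup>2)" for t :: real
  have in_ball: "of_real t * z \<in> ball 0 1" if "0 \<le> t" "t \<le> 1" for t :: real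
    using that z mult_left_le_one_le[of "norm z" t] by (simp add: norm_mult)
  have der: "\<exists>y. DERIV u t :> y \<and> y \<ge> 0" if t: "0 < t" "t \<le> 1" for t
  proof -
    define w where "w = of_real t * z"
    define D where "D = z * deriv F w"
    have wb: "w \<in> ball 0 1"
      using in_ball t by (simp add: w_def)
    have "(F has_field_derivative deriv F w) (at w)"
      using hol wb by (intro holomorphic_derivI) auto
    moreover have "((\<lambda>t. of_real t * z) has_vector_derivative z) (at t)"
      by (auto intro!: derivative_eq_intros)
    ultimately have V: "((\<lambda>t. F (of_real t * z)) has_vector_derivative D) (at t)"
      using field_vector_diff_chain_at[of "\<lambda>t. of_real t * z" z t F "deriv F w"]
      by (simp add: o_def D_def w_def)
    define y where "y = real k * t ^ (k - 1) * ((Re (F w))\<^sup>2 + (Im (F w))\<^sup>2)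
        + t ^ k * (2 * (Re (F w) * Re D + Im (F w) * Im D))"
    have "DERIV u t :> y"
      unfolding u_def y_def
      by (rule derivative_eq_intros V refl | simp add: w_def algebra_simps)+
    moreover have "y \<ge> 0"
    proof (cases "F w = 0")
      case False
      define N where "N = (Re (F w))\<^sup>2 + (Im (F w))\<^sup>2"
      have N: "N > 0"
        using False unfolding N_def by (simp add: complex_neq_0)
      \<comment> \<open>The radial derivative of |F|^2 is twice the bracket on the left, which ties
        it to the logarithmic derivative.\<close>
      have "t * (Re (F w) * Re D + Im (F w) * Im D) = N * Re (w * (deriv F w / F w))"
      proof -
        have "Re (w * (deriv F w / F w)) = Re (of_real t * (D / F w))"
          by (simp add: w_def D_def mult.assoc)
        also have "\<dots> = t * Re (D / F w)"
          by (simp only: times_complex.sel Re_complex_of_real Im_complex_of_real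
              mult_zero_left diff_zero)
        also have "\<dots> = t * (Re (F w) * Re D + Im (F w) * Im D) / N"
          by (simp add: Re_divide N_def algebra_simps)
        finally show ?thesis
          using N by simp
      qed
      moreover have "N * Re (w * (deriv F w / F w)) \<ge> N * - (real k / 2)"
        using lower[OF wb] N by (intro mult_left_mono) auto
      ultimately have "real k * N + 2 * (t * (Re (F w) * Re D + Im (F w) * Im D)) \<ge> 0"
        by (simp add: algebra_simps)
      \<comment> \<open>Multiplying by t > 0 restores the exponent k lowered by differentiation; k =
        0 is separate because of truncated subtraction.\<close>
      moreover have "t * y = t ^ k * (real k * N + 2 * (t * (Re (F w) * Re D + Im (F w) * Im D)))"
        by (cases k) (simp_all add: y_def N_def algebra_simps)
      ultimately have "t * y \<ge> 0"
        using t by simp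
      then show ?thesis
        using t by (simp add: zero_le_mult_iff)
    qed (simp add: y_def)
    ultimately show ?thesis
      by blast
  qed
  have "((\<lambda>t. F (of_real t * z)) \<longlongrightarrow> F 0) (at_right (0 :: real))"
  proof -
    have "isCont F 0"
      using holomorphic_on_imp_continuous_on[OF hol]
      by (simp add: continuous_on_eq_continuous_at)
    moreover have "((\<lambda>t. of_real t * z) \<longlongrightarrow> 0) (at_right (0 :: real))"
      by (auto intro!: tendsto_eq_intros)
    ultimately show ?thesis
      using isCont_tendsto_compose by fastforce
  qed
  then have "eventually (\<lambda>t. F (of_real t * z) \<noteq> 0) (at_right (0 :: real))"
    using F0 by (rule tendsto_imp_eventually_ne)
  moreover have "eventually (\<lambda>t. t \<in> {0<..<1}) (at_right (0 :: real))"
    by (rule eventually_at_rightI[of _ 1]) auto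
  ultimately have "eventually (\<lambda>t. F (of_real t * z) \<noteq> 0 \<and> t \<in> {0<..<1}) (at_right (0 :: real))"
    by eventually_elim simp
  then obtain t :: real where t: "F (of_real t * z) \<noteq> 0" "0 < t" "t < 1"
    using eventually_happens'[OF trivial_limit_at_right_real] by auto
  have "u t \<le> u 1"
    by (rule DERIV_nonneg_imp_nondecreasing) (use t der in auto)
  moreover have "u t > 0"
    using t by (auto simp: u_def complex_neq_0[symmetric])
  ultimately show False
    by (simp add: u_def Fz)
qed

text \<open>Comparing coefficients gives n F_n as the sum of F_k Q_(n-k) over k < n, whence
  induction. The bound is the coefficient of (1 - X)^(-3), for which Q = 3X / (1 - X) and every
  estimate is an equality.\<close>

lemma fps_log_derivative_coefficient_bound:
  fixes F Q :: "complex fps"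
  assumes eq: "fps_X * fps_deriv F = Q * F" and F0: "fps_nth F 0 = 1"
    and Q0: "fps_nth Q 0 = 0" and Q: "\<And>n. n \<ge> 1 \<Longrightarrow> norm (fps_nth Q n) \<le> 3"
  shows "norm (fps_nth F n) \<le> real ((n + 1) * (n + 2)) / 2"
proof (induction n rule: less_induct)
  case (less n)
  show ?case
  proof (cases "n = 0")
    case False
    have "of_nat n * fps_nth F n = fps_nth (F * Q) n"
      using arg_cong[OF eq, of "\<lambda>G. fps_nth G n"] False by (simp add: mult.commute)
    \<comment> \<open>The term k = n drops out since Q has no constant term, so only earlier
      coefficients of F remain.\<close>
    also have "\<dots> = (\<Sum>k<n. fps_nth F k * fps_nth Q (n - k))"
      using Q0 by (simp add: fps_mult_nth atLeast0AtMost lessThan_Suc_atMost[symmetric])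
    finally have "real n * norm (fps_nth F n) = norm (\<Sum>k<n. fps_nth F k * fps_nth Q (n - k))"
      by (metis norm_mult norm_of_nat)
    also have "\<dots> \<le> (\<Sum>k<n. real ((k + 1) * (k + 2)) / 2 * 3)"
    proof (rule sum_norm_le)
      fix k assume "k \<in> {..<n}"
      then show "norm (fps_nth F k * fps_nth Q (n - k)) \<le> real ((k + 1) * (k + 2)) / 2 * 3"
        unfolding norm_mult by (intro mult_mono less.IH Q) auto
    qed
    also have "\<dots> = real n * (real ((n + 1) * (n + 2)) / 2)"
      by (induction n) (simp_all add: field_simps)
    finally show ?thesis
      using False by (simp del: of_nat_mult)
  qed (simp add: F0)
qed

theorem theorem1:
  fixes f h g :: "complex \<Rightarrow> complex" and a b :: "nat \<Rightarrow> complex" and \<theta> :: real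
  assumes "harmonic_map_on f (ball 0 1)"
    and "h analytic_on ball 0 1" and "g analytic_on ball 0 1"
    and "\<And>z. z \<in> ball 0 1 \<Longrightarrow> f z = h z + cnj (g z)"
    and "a 1 = 1"
    and "\<And>z. z \<in> ball 0 1 \<Longrightarrow> (\<lambda>j. a (j + 2) * z ^ (j + 2)) sums (h z - z)"
    and "\<And>z. z \<in> ball 0 1 \<Longrightarrow> (\<lambda>j. b (j + 1) * z ^ (j + 1)) sums g z"
    and "norm (b 1) < 1"
    and "\<And>z. z \<in> ball 0 1 \<Longrightarrow> deriv g z = exp (\<i> * of_real \<theta>) * z * deriv h z"
    and "\<And>z. z \<in> ball 0 1 \<Longrightarrow> Re (1 + z * (deriv (deriv h) z / deriv h z)) > - (1 / 2)"
  shows "\<forall>j\<ge>1. norm (a j) \<le> (real j + 1) / 2 \<and> norm (b j) \<le> (real j - 1) / 2"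
proof -
  \<comment> \<open>Both series start at index 1, so the values \<open>a 0\<close> and
    \<open>b 0\<close> are replaced by 0.\<close>
  define A where "A = Abs_fps (\<lambda>n. if n = 0 then 0 else a n)"
  define B where "B = Abs_fps (\<lambda>n. if n = 0 then 0 else b n)"
  have hol_h: "h holomorphic_on ball 0 1"
    using assms(2) by (rule analytic_imp_holomorphic)
  have hol_h': "deriv h holomorphic_on ball 0 1" and hol_h'': "deriv (deriv h) holomorphic_on ball 0 1"
    using hol_h by (simp_all add: holomorphic_deriv)
  have in0: "(0 :: complex) \<in> ball 0 1"
    by simp
  have ev: "eventually (\<lambda>z. z \<in> ball 0 1) (nhds (0 :: complex))"
    using eventually_nhds_in_open[OF open_ball in0] .
  have hA: "h has_fps_expansion A"
  proof (intro has_fps_expansionI eventually_mono[OF ev])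
    fix z :: complex assume "z \<in> ball 0 1"
    from assms(6)[OF this] have "(\<lambda>j. fps_nth A (j + 2) * z ^ (j + 2)) sums (h z - z)"
      by (simp add: A_def)
    then show "(\<lambda>n. fps_nth A n * z ^ n) sums h z"
      by (subst (asm) sums_iff_shift) (use assms(5) in \<open>simp add: A_def numeral_2_eq_2\<close>)
  qed
  have gB: "g has_fps_expansion B"
  proof (intro has_fps_expansionI eventually_mono[OF ev])
    fix z :: complex assume "z \<in> ball 0 1"
    from assms(7)[OF this] have "(\<lambda>j. fps_nth B (j + 1) * z ^ (j + 1)) sums g z"
      by (simp add: B_def)
    then show "(\<lambda>n. fps_nth B n * z ^ n) sums g z"
      by (subst (asm) sums_iff_shift) (simp add: B_def)
  qed
  note h'A = has_fps_expansion_deriv[OF hA]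
  have h'0: "deriv h 0 = 1"
    using fps_nth_fps_expansion[OF h'A, of 0] assms(5) by (simp add: A_def)
  have Re_log: "Re (z * (deriv (deriv h) z / deriv h z)) > - (3 / 2)" if "z \<in> ball 0 1" for z
    using assms(10)[OF that] by simp
  \<comment> \<open>The bound -3/2 is -k/2 with k = 3. Nonvanishing of h' makes the quotient
    \<open>q\<close> below holomorphic.\<close>
  have nz: "deriv h z \<noteq> 0" if "z \<in> ball 0 1" for z
    using log_derivative_bounded_below_imp_nonzero[OF hol_h', of 3 z] Re_log that h'0
    by (simp add: less_imp_le)
  define q where "q z = z * (deriv (deriv h) z / deriv h z)" for z
  have hol_q: "q holomorphic_on ball 0 1"
    unfolding q_def by (intro holomorphic_intros hol_h' hol_h'') (use nz in auto)
  define Q where "Q = fps_expansion q 0"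
  have qQ: "q has_fps_expansion Q"
    unfolding Q_def by (rule has_fps_expansion_fps_expansion[OF open_ball in0 hol_q])
  have Q0: "fps_nth Q 0 = 0"
    using fps_nth_fps_expansion[OF qQ, of 0] by (simp add: q_def)
  \<comment> \<open>Adding 3/2 makes the real part positive and changes only the constant term; the
    bound is 2 * 3/2.\<close>
  have Q: "norm (fps_nth Q n) \<le> 3" if n: "n \<ge> 1" for n
  proof -
    let ?p = "\<lambda>z. 3 / 2 + q z"
    have "?p has_fps_expansion fps_const (3 / 2) + Q"
      by (intro fps_expansion_intros qQ)
    from fps_nth_fps_expansion[OF this, of n] n
    have "fps_nth Q n = (deriv ^^ n) ?p 0 / fact n"
      by simp
    moreover have "norm ((deriv ^^ n) ?p 0 / fact n) \<le> 2 * Re (?p 0)"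
      by (intro caratheodory_coefficient_bound holomorphic_intros hol_q n)
        (use Re_log in \<open>force simp: q_def\<close>)
    ultimately show ?thesis
      by (simp add: q_def)
  qed
  \<comment> \<open>Two expansions of z h'' must agree, which gives the power series equation with F
    the series of h'.\<close>
  have "(\<lambda>z. z * deriv (deriv h) z) has_fps_expansion fps_X * fps_deriv (fps_deriv A)"
    by (intro fps_expansion_intros hA)
  moreover have "(\<lambda>z. z * deriv (deriv h) z) has_fps_expansion Q * fps_deriv A"
  proof (subst has_fps_expansion_cong[OF _ refl])
    show "(\<lambda>z. q z * deriv h z) has_fps_expansion Q * fps_deriv A"
      by (intro fps_expansion_intros qQ hA)
    show "eventually (\<lambda>z. z * deriv (deriv h) z = q z * deriv h z) (nhds 0)"
      using ev by eventually_elim (simp add: q_def nz)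
  qed
  ultimately have "fps_X * fps_deriv (fps_deriv A) = Q * fps_deriv A"
    by (rule fps_expansion_unique_complex)
  then have h'_bound: "norm (fps_nth (fps_deriv A) n) \<le> real ((n + 1) * (n + 2)) / 2" for n
    by (rule fps_log_derivative_coefficient_bound) (use Q0 Q assms(5) in \<open>simp_all add: A_def\<close>)
  define e where "e = exp (\<i> * of_real \<theta>)"
  have "deriv g has_fps_expansion fps_deriv B"
    by (intro fps_expansion_intros gB)
  moreover have "deriv g has_fps_expansion fps_const e * (fps_X * fps_deriv A)"
  proof (subst has_fps_expansion_cong[OF _ refl])
    show "(\<lambda>z. e * (z * deriv h z)) has_fps_expansion fps_const e * (fps_X * fps_deriv A)"
      by (intro fps_expansion_intros hA)
    show "eventually (\<lambda>z. deriv g z = e * (z * deriv h z)) (nhds 0)"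
      using ev by eventually_elim (simp add: e_def assms(9))
  qed
  ultimately have gh: "fps_deriv B = fps_const e * (fps_X * fps_deriv A)"
    by (rule fps_expansion_unique_complex)
  have "norm (a (Suc n)) \<le> (real (Suc n) + 1) / 2 \<and> norm (b (Suc n)) \<le> (real (Suc n) - 1) / 2" for n
  proof
    \<comment> \<open>Coefficient n of h' is (n + 1) a_(n+1), so the factor n + 1 cancels from the
      bound (n + 1)(n + 2) / 2.\<close>
    have "real (Suc n) * norm (a (Suc n)) = norm (fps_nth (fps_deriv A) n)"
      by (simp add: A_def norm_mult del: of_nat_Suc)
    also have "\<dots> \<le> real (Suc n) * ((real (Suc n) + 1) / 2)"
      using h'_bound[of n] by (simp add: field_simps)
    finally show "norm (a (Suc n)) \<le> (real (Suc n) + 1) / 2"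
      by (simp only: mult_le_cancel_left_pos of_nat_0_less_iff zero_less_Suc)
    have "real (Suc n) * norm (b (Suc n)) = norm (fps_nth (fps_deriv B) n)"
      by (simp add: B_def norm_mult del: of_nat_Suc)
    \<comment> \<open>The factor \<open>e\<close> has modulus 1 and multiplication by z shifts the
      index by one; at n = 0 this gives b_1 = 0.\<close>
    also have "\<dots> = (if n = 0 then 0 else norm (fps_nth (fps_deriv A) (n - 1)))"
      by (simp add: gh e_def norm_mult del: fps_deriv_nth)
    also have "\<dots> \<le> real (Suc n) * ((real (Suc n) - 1) / 2)"
      using h'_bound[of "n - 1"] by (cases n) (simp_all add: field_simps del: fps_deriv_nth)
    finally show "norm (b (Suc n)) \<le> (real (Suc n) - 1) / 2"
      by (simp only: mult_le_cancel_left_pos of_nat_0_less_iff zero_less_Suc)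
  qed
  then show ?thesis
    by (metis Suc_le_D One_nat_def)
qed

end
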